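(* For $n\geq 2$, $a_n(321;231) = n-1$.
   Context: $\mathcal{S}_n$ is the set of permutations of $[n]=\{1,\dots,n\}$, written in one-line notation $\pi=\pi_1\pi_2\cdots\pi_n$ with $\pi_i=\pi(i)$. A permutation is cyclic if it consists of exactly one $n$-cycle. For a cyclic $\pi$, its standard cycle notation is $C(\pi)=(c_1,c_2,\dots,c_n)$ with $c_1=1$ and $c_i=\pi_{c_{i-1}}$ for $2\le i\le n$. A sequence of distinct integers $w_1\cdots w_m$ contains a pattern $\sigma\in\mathcal{S}_k$ if there are indices $i_1<\dots<i_k$ with $w_{i_1}\cdots w_{i_k}$ in the same relative order as $\sigma_1\cdots\sigma_k$; otherwise it avoids $\sigma$. For $\sigma,\tau\in\mathcal{S}_3$, $\mathcal{A}_n(\sigma;\tau)$ is the set of cyclic permutations $\pi\in\mathcal{S}_n$ whose one-line notation avoids $\sigma$ and whose cycle notation $C(\pi)$ (as the sequence $c_1c_2\cdots c_n$) avoids $\tau$; $a_n(\sigma;\tau)=|\mathcal{A}_n(\sigma;\tau)|$. *)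

theory Defs
  imports "HOL-Combinatorics.Permutations" "HOL-Combinatorics.Orbits"
begin

text \<open>
  Words and patterns are lists of naturals; a pattern in the symmetric group on 3 letters is given
  by its one-line notation, e.g. 321 is the list \<open>[3, 2, 1]\<close>. The map \<open>f\<close> below picks the
  (0-based) positions of an occurrence of the pattern.
\<close>

definition contains_pattern :: "nat list \<Rightarrow> nat list \<Rightarrow> bool" where
  "contains_pattern w s \<longleftrightarrow>
     (\<exists>f :: nat \<Rightarrow> nat. strict_mono_on {..<length s} f \<and> f ` {..<length s} \<subseteq> {..<length w} \<and>
        (\<forall>a<length s. \<forall>b<length s. w ! f a < w ! f b \<longleftrightarrow> s ! a < s ! b))"

abbreviation avoids_pattern :: "nat list \<Rightarrow> nat list \<Rightarrow> bool" where
  "avoids_pattern w s \<equiv> \<not> contains_pattern w s"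

definition one_line :: "nat \<Rightarrow> (nat \<Rightarrow> nat) \<Rightarrow> nat list" where
  "one_line n p = map p [1..<n + 1]"

text \<open>
  The sequence \<open>1, p 1, p (p 1), \<dots>\<close> of length \<open>n\<close>; it is the standard cycle notation when \<open>p\<close> is
  a cyclic permutation of \<open>{1..n}\<close>.
\<close>

definition cycle_notation :: "nat \<Rightarrow> (nat \<Rightarrow> nat) \<Rightarrow> nat list" where
  "cycle_notation n p = map (\<lambda>i. (p ^^ i) 1) [0..<n]"

definition cyclic_avoiders :: "nat \<Rightarrow> nat list \<Rightarrow> nat list \<Rightarrow> (nat \<Rightarrow> nat) set" where
  "cyclic_avoiders n s t =
     {p. p permutes {1..n} \<and> cyclic_on p {1..n} \<and>
         avoids_pattern (one_line n p) s \<and> avoids_pattern (cycle_notation n p) t}"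

end

theory Submission
  imports Defs
begin

text \<open>
  Let \<open>m\<close> be the last entry of the cycle notation, that is, \<open>p m = 1\<close>. Avoiding 321 forces the
  one-line notation to increase to the left of the entry 1 in position \<open>m\<close>; avoiding 231 forces
  the entries larger than \<open>m\<close> to decrease in the cycle notation. If \<open>j < m - 1\<close> were minimal with
  \<open>p j \<noteq> j + 1\<close>, then \<open>j + 1\<close> would occur in the cycle notation after an entry \<open>x > m\<close>, and either
  \<open>p j, p (j + 1), m\<close> or \<open>p j, x, j + 1\<close> would be an occurrence of 231. Hence the cycle notation
  is \<open>1, \<dots>, m - 1, n, n - 1, \<dots>, m\<close>, with one such permutation for every \<open>m\<close> from 2 to \<open>n\<close>.
\<close>

section \<open>Occurrences of three-letter patterns as triples of positions\<close>

lemma contains_pattern_length_3: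
  "contains_pattern w [x, y, z] \<longleftrightarrow>
     (\<exists>i j k. i < j \<and> j < k \<and> k < length w \<and>
        (w ! i < w ! j \<longleftrightarrow> x < y) \<and> (w ! j < w ! i \<longleftrightarrow> y < x) \<and>
        (w ! i < w ! k \<longleftrightarrow> x < z) \<and> (w ! k < w ! i \<longleftrightarrow> z < x) \<and>
        (w ! j < w ! k \<longleftrightarrow> y < z) \<and> (w ! k < w ! j \<longleftrightarrow> z < y))"
    (is "?L \<longleftrightarrow> ?R")
proof
  have all3: "(\<forall>a<length [x, y, z]. P a) \<longleftrightarrow> P 0 \<and> P 1 \<and> P 2" for P
    by (auto simp: less_Suc_eq numeral_2_eq_2)
  {
    assume ?L
    then obtain f where f: "strict_mono_on {..<length [x, y, z]} f"
        "f ` {..<length [x, y, z]} \<subseteq> {..<length w}"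
        "\<forall>a<length [x, y, z]. \<forall>b<length [x, y, z].
           w ! f a < w ! f b \<longleftrightarrow> [x, y, z] ! a < [x, y, z] ! b"
      unfolding contains_pattern_def by blast
    have "f 0 < f 1" "f 1 < f 2"
      using f(1) by (auto simp: strict_mono_on_def)
    moreover have "f 2 < length w"
      using f(2) by (simp add: image_subset_iff)
    ultimately show ?R
      using f(3) unfolding all3 by (intro exI[of _ "f 0"] exI[of _ "f 1"] exI[of _ "f 2"]) simp
  next
    assume ?R
    then obtain i j k where ijk: "i < j" "j < k" "k < length w"
        "w ! i < w ! j \<longleftrightarrow> x < y" "w ! j < w ! i \<longleftrightarrow> y < x"
        "w ! i < w ! k \<longleftrightarrow> x < z" "w ! k < w ! i \<longleftrightarrow> z < x"
        "w ! j < w ! k \<longleftrightarrow> y < z" "w ! k < w ! j \<longleftrightarrow> z < y"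
      by blast
    define f where "f a = [i, j, k] ! a" for a
    have f: "f 0 = i" "f 1 = j" "f (Suc 0) = j" "f 2 = k"
      by (simp_all add: f_def)
    show ?L
      unfolding contains_pattern_def
    proof (intro exI[of _ f] conjI)
      show "strict_mono_on {..<length [x, y, z]} f"
        using ijk(1,2) by (auto simp: strict_mono_on_def less_Suc_eq f_def)
      show "f ` {..<length [x, y, z]} \<subseteq> {..<length w}"
        using ijk(1-3) by (auto simp: less_Suc_eq f_def)
      show "\<forall>a<length [x, y, z]. \<forall>b<length [x, y, z].
              w ! f a < w ! f b \<longleftrightarrow> [x, y, z] ! a < [x, y, z] ! b"
        unfolding all3 f using ijk by simp
    qed
  }
qed

lemma one_line_contains_321:
  "contains_pattern (one_line n p) [3, 2, 1] \<longleftrightarrow>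
     (\<exists>i j k. 1 \<le> i \<and> i < j \<and> j < k \<and> k \<le> n \<and> p k < p j \<and> p j < p i)"
    (is "?L \<longleftrightarrow> ?R")
proof
  assume ?L
  then obtain i j k where "i < j" "j < k" "k < n" "p (Suc k) < p (Suc j)" "p (Suc j) < p (Suc i)"
    unfolding contains_pattern_length_3 by (auto simp: one_line_def simp del: upt_Suc)
  then show ?R
    by (intro exI[of _ "Suc i"] exI[of _ "Suc j"] exI[of _ "Suc k"]) auto
next
  assume ?R
  then obtain i j k where "1 \<le> i" "i < j" "j < k" "k \<le> n" "p k < p j" "p j < p i"
    by blast
  then show ?L
    unfolding contains_pattern_length_3
    by (intro exI[of _ "i - 1"] exI[of _ "j - 1"] exI[of _ "k - 1"])
      (auto simp: one_line_def simp del: upt_Suc)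
qed

lemma cycle_notation_contains_231:
  "contains_pattern (cycle_notation n p) [2, 3, 1] \<longleftrightarrow>
     (\<exists>i j k. i < j \<and> j < k \<and> k < n \<and> (p ^^ k) 1 < (p ^^ i) 1 \<and> (p ^^ i) 1 < (p ^^ j) 1)"
    (is "?L \<longleftrightarrow> ?R")
proof
  assume ?L
  then obtain i j k where
      "i < j" "j < k" "k < n" "(p ^^ k) 1 < (p ^^ i) 1" "(p ^^ i) 1 < (p ^^ j) 1"
    unfolding contains_pattern_length_3 by (auto simp: cycle_notation_def)
  then show ?R
    by blast
next
  assume ?R
  then obtain i j k where
      "i < j" "j < k" "k < n" "(p ^^ k) 1 < (p ^^ i) 1" "(p ^^ i) 1 < (p ^^ j) 1"
    by blast
  then show ?L
    unfolding contains_pattern_length_3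
    by (intro exI[of _ i] exI[of _ j] exI[of _ k]) (auto simp: cycle_notation_def)
qed

section \<open>Enumeration of a cycle by iterates; tight decreasing sequences\<close>

lemma cyclic_on_funpow_bij_betw:
  assumes "cyclic_on f S" "s \<in> S"
  shows "bij_betw (\<lambda>i. (f ^^ i) s) {..<card S} S" and "(f ^^ card S) s = s"
proof -
  have S: "orbit f s = S"
    using assms by (rule orbit_cyclic_eq3)
  then have s: "s \<in> orbit f s"
    using assms(2) by simp
  \<comment> \<open>\<open>funpow_dist1 f s s\<close> is the first return time to \<open>s\<close>.
    The iterates before it run through the orbit without repetition, so it must equal
    \<open>card S\<close>.\<close>
  have bij: "bij_betw (\<lambda>i. (f ^^ i) s) {0..<funpow_dist1 f s s} S"
    using inj_on_funpow_dist1[OF s] orbit_conv_funpow_dist1[OF s] S by (simp add: bij_betw_def)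
  then have "card S = funpow_dist1 f s s"
    using bij_betw_same_card by fastforce
  then show "bij_betw (\<lambda>i. (f ^^ i) s) {..<card S} S" "(f ^^ card S) s = s"
    using bij funpow_dist1_prop[OF s] by (simp_all add: lessThan_atLeast0)
qed

text \<open>As \<open>f\<close> drops by at least 1 at each step, \<open>f i + i\<close> never
  increases. The range bounds it by \<open>l + b\<close> from above at \<open>i = a\<close> and from
  below at \<open>i = b\<close>, so it is constant.\<close>

lemma strict_antimono_on_atLeastAtMost_eq:
  fixes f :: "nat \<Rightarrow> nat"
  assumes decr: "\<And>i j. a \<le> i \<Longrightarrow> i < j \<Longrightarrow> j \<le> b \<Longrightarrow> f j < f i"
    and range: "\<And>i. a \<le> i \<Longrightarrow> i \<le> b \<Longrightarrow> l \<le> f i \<and> f i \<le> l + (b - a)"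
    and i: "a \<le> i" "i \<le> b"
  shows "f i = l + (b - i)"
proof (rule antisym)
  have "i \<le> b \<longrightarrow> f i + i \<le> l + b"
    using i(1)
  proof (induction rule: dec_induct)
    case base
    then show ?case using range[of a] by auto
  next
    case (step j)
    then show ?case using decr[of j "Suc j"] by auto
  qed
  then show "f i \<le> l + (b - i)"
    using i by linarith
  have "a \<le> i \<longrightarrow> l + b \<le> f i + i"
    using i(2)
  proof (induction rule: inc_induct)
    case base
    then show ?case using range[of b] by auto
  next
    case (step j)
    then show ?case using decr[of j "Suc j"] by auto
  qed
  then show "l + (b - i) \<le> f i"
    using i by linarith
qed

section \<open>The permutations with cycle notation
  \<open>1, ..., m - 1, n, n - 1, ..., m\<close>\<close>

definition run_perm :: "nat \<Rightarrow> nat \<Rightarrow> nat \<Rightarrow> nat" where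
  "run_perm n m i =
     (if i = 0 \<or> n < i then i else if Suc i < m then Suc i else if Suc i = m then n
      else if i = m then 1 else i - 1)"

lemma run_perm_permutes:
  assumes "2 \<le> m" "m \<le> n"
  shows "run_perm n m permutes {1..n}"
proof (rule inj_imp_permutes)
  show "inj_on (run_perm n m) {1..n}"
    using assms by (auto simp: inj_on_def run_perm_def split: if_splits)
qed (use assms in \<open>auto simp: run_perm_def split: if_splits\<close>)

lemma funpow_run_perm:
  assumes "2 \<le> m" "m \<le> n" "i < n"
  shows "(run_perm n m ^^ i) 1 = (if Suc i < m then Suc i else m + (n - 1 - i))"
  using \<open>i < n\<close>
proof (induction i)
  case 0
  then show ?case using assms by simp
next
  case (Suc i)
  then show ?case using assms(1,2) by (auto simp: run_perm_def)
qed

lemma run_perm_cyclic: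
  assumes "2 \<le> m" "m \<le> n"
  shows "cyclic_on (run_perm n m) {1..n}"
proof (rule cyclic_on_singleI)
  show "1 \<in> {1..n}"
    using assms by simp
  have "n = Suc (n - 1)"
    using assms by simp
  then have "(run_perm n m ^^ n) 1 = run_perm n m ((run_perm n m ^^ (n - 1)) 1)"
    by (metis funpow.simps(2) comp_apply)
  also have "(run_perm n m ^^ (n - 1)) 1 = m"
    using assms by (subst funpow_run_perm) auto
  also have "run_perm n m m = 1"
    using assms by (simp add: run_perm_def)
  finally have closed: "(run_perm n m ^^ n) 1 = 1" .
  have "orbit (run_perm n m) 1 = {(run_perm n m ^^ i) 1 | i. i < n}"
    using closed assms by (intro orbit_altdef_bounded) auto
  moreover have "\<exists>i<n. (run_perm n m ^^ i) 1 = x" if "x \<in> {1..n}" for x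
  proof (cases "x < m")
    case True
    then show ?thesis
      using that assms by (intro exI[of _ "x - 1"]) (auto simp: funpow_run_perm simp del: One_nat_def)
  next
    case False
    then show ?thesis
      using that assms by (intro exI[of _ "n - 1 - (x - m)"]) (auto simp: funpow_run_perm simp del: One_nat_def)
  qed
  moreover have "(run_perm n m ^^ i) 1 \<in> {1..n}" if "i < n" for i
    using that assms by (auto simp: funpow_run_perm simp del: One_nat_def)
  ultimately show "{1..n} = orbit (run_perm n m) 1"
    by (intro set_eqI iffI) (force, force)
qed

text \<open>The one-line notation is \<open>2, ..., m - 1, n\<close> followed by
  \<open>1, m, ..., n - 1\<close>: two increasing blocks leave no room for 321. In the cycle
  notation, an entry with a smaller one after it lies in the final decreasing run, where nothing
  larger follows it, so 231 cannot occur.\<close>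

lemma run_perm_in_cyclic_avoiders:
  assumes "2 \<le> m" "m \<le> n"
  shows "run_perm n m \<in> cyclic_avoiders n [3, 2, 1] [2, 3, 1]"
proof -
  have "\<not> contains_pattern (one_line n (run_perm n m)) [3, 2, 1]"
    unfolding one_line_contains_321 using assms by (auto simp: run_perm_def split: if_splits)
  moreover have "\<not> contains_pattern (cycle_notation n (run_perm n m)) [2, 3, 1]"
    unfolding cycle_notation_contains_231
    using assms by (auto simp: funpow_run_perm simp del: One_nat_def split: if_splits)
  ultimately show ?thesis
    using run_perm_permutes[OF assms] run_perm_cyclic[OF assms] by (simp add: cyclic_avoiders_def)
qed

text \<open>The parameter \<open>m\<close> can be recovered as the preimage of 1.\<close>

lemma inj_on_run_perm: "inj_on (run_perm n) {2..n}"
proof (rule inj_onI)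
  fix m m'
  assume m: "m \<in> {2..n}" "m' \<in> {2..n}" and eq: "run_perm n m = run_perm n m'"
  have "run_perm n m m = 1"
    using m by (simp add: run_perm_def)
  then have "run_perm n m' m = 1"
    unfolding eq .
  moreover have "run_perm n m' m \<noteq> 1" if "m \<noteq> m'"
    using that m unfolding run_perm_def atLeastAtMost_iff by presburger
  ultimately show "m = m'"
    by blast
qed

section \<open>The shape of an arbitrary avoider\<close>

lemma cyclic_avoider_eq_run_perm:
  assumes n: "2 \<le> n" and p: "p \<in> cyclic_avoiders n [3, 2, 1] [2, 3, 1]"
  shows "\<exists>m\<in>{2..n}. p = run_perm n m"
proof -
  define c where "c i = (p ^^ i) 1" for i
  have perm: "p permutes {1..n}" and cyc: "cyclic_on p {1..n}"
    using p by (auto simp: cyclic_avoiders_def)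
  have no_321: "False" if "1 \<le> i" "i < j" "j < k" "k \<le> n" "p k < p j" "p j < p i" for i j k
    using p that unfolding cyclic_avoiders_def one_line_contains_321 by blast
  have no_231: "False" if "i < j" "j < k" "k < n" "c k < c i" "c i < c j" for i j k
    using p that unfolding cyclic_avoiders_def cycle_notation_contains_231 c_def by blast
  have bij: "bij_betw c {..<n} {1..n}" and "c n = 1"
    using cyclic_on_funpow_bij_betw[OF cyc, of 1] n by (simp_all add: c_def[abs_def])
  have c_inj: "i = j" if "c i = c j" "i < n" "j < n" for i j
    using bij that by (auto simp: bij_betw_def inj_on_def)
  have c_range: "1 \<le> c i \<and> c i \<le> n" if "i < n" for i
    using bij_betwE[OF bij] that by auto
  have c_surj: "\<exists>i<n. c i = x" if "1 \<le> x" "x \<le> n" for x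
    using bij that unfolding bij_betw_def by (metis atLeastAtMost_iff imageE lessThan_iff)
  have c_Suc: "c (Suc i) = p (c i)" for i
    by (simp add: c_def)
  have p_inj: "i = j" if "p i = p j" for i j
    using permutes_inj[OF perm] that by (simp add: inj_def)
  have p_range: "1 \<le> p i \<and> p i \<le> n" if "1 \<le> i" "i \<le> n" for i
    using permutes_in_image[OF perm, of i] that by auto
  define m where "m = c (n - 1)"
  have "p m = 1"
    using c_Suc[of "n - 1"] \<open>c n = 1\<close> n by (simp add: m_def)
  have "m \<noteq> 1"
    using c_inj[of "n - 1" 0] n by (auto simp: m_def c_def)
  then have m: "2 \<le> m" "m \<le> n"
    using c_range[of "n - 1"] n by (auto simp: m_def)
  \<comment> \<open>Otherwise \<open>p i\<close>, \<open>p j\<close> and the entry 1 in position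
    \<open>m\<close> would form a 321.\<close>
  have incr: "p i < p j" if "1 \<le> i" "i < j" "j < m" for i j
  proof (rule ccontr)
    assume "\<not> p i < p j"
    then have "p j < p i"
      using p_inj[of i j] that by linarith
    moreover have "p m < p j"
      using p_inj[of j m] p_range[of j] that m \<open>p m = 1\<close> by fastforce
    ultimately show False
      using no_321[of i j m] that m by simp
  qed
  have run: "1 \<le> j \<longrightarrow> Suc j < m \<longrightarrow> p j = Suc j" for j
  proof (induction j rule: less_induct)
    case (less j)
    show ?case
    proof (intro impI, rule ccontr)
      assume j: "1 \<le> j" "Suc j < m" and "p j \<noteq> Suc j"
      have prev: "p i = Suc i" if "1 \<le> i" "i < j" for i
        using less that j by simp
      have c_prev: "c i = Suc i" if "i < j" for i
        using that
      proof (induction i)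
        case 0
        then show ?case by (simp add: c_def)
      next
        case (Suc i)
        then show ?case using prev[of "Suc i"] by (simp add: c_Suc)
      qed
      have cj: "c j = p j"
        using c_Suc[of "j - 1"] c_prev[of "j - 1"] j by simp
      \<comment> \<open>These values are taken: 1 is the image of \<open>m\<close>, and any other
        \<open>i\<close> up to \<open>j\<close> is the image of \<open>i - 1\<close>.\<close>
      have "p j \<noteq> i" if "1 \<le> i" "i \<le> j" for i
      proof (cases "i = 1")
        case True
        then show ?thesis using p_inj[of j m] \<open>p m = 1\<close> j by auto
      next
        case False
        then show ?thesis using p_inj[of j "i - 1"] prev[of "i - 1"] that by auto
      qed
      from this[of "p j"] have pj: "Suc j < p j"
        using \<open>p j \<noteq> Suc j\<close> p_range[of j] j m by linarith
      obtain t where t: "t < n" "c t = Suc j"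
        using c_surj[of "Suc j"] j m by auto
      \<comment> \<open>Positions are 0-based: positions before \<open>j\<close> hold
        \<open>1, ..., j\<close>, and position \<open>j\<close> holds \<open>p j\<close>, which
        exceeds \<open>j + 1\<close>.\<close>
      have "j < t"
        using c_prev[of t] t(2) cj pj by (metis linorder_neqE_nat nat.inject less_irrefl)
      define x where "x = c (t - 1)"
      have px: "p x = Suc j"
        using c_Suc[of "t - 1"] t \<open>j < t\<close> by (simp add: x_def)
      have x: "1 \<le> x" "x \<le> n"
        using c_range[of "t - 1"] t by (auto simp: x_def)
      \<comment> \<open>The predecessor \<open>x\<close> of \<open>j + 1\<close> is located by
        elimination: \<open>x < j\<close> would give \<open>p x = x + 1 < j + 1\<close>, and
        \<open>x\<close> strictly between \<open>j\<close> and \<open>m\<close> would give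
        \<open>p x > p j > j + 1\<close>.\<close>
      have "\<not> x < j"
        using prev[of x] px x by auto
      moreover have "x \<noteq> j" "x \<noteq> m"
        using px \<open>p j \<noteq> Suc j\<close> \<open>p m = 1\<close> j by auto
      moreover have "\<not> (j < x \<and> x < m)"
        using incr[of j x] px pj j by auto
      ultimately have "m < x"
        by linarith
      have "t \<noteq> n - 1"
        using t(2) j by (auto simp: m_def)
      then have "Suc t \<le> n - 1"
        using t(1) by linarith
      have c_after: "c j < c (Suc t)"
        using incr[of j "Suc j"] j t(2) cj by (simp add: c_Suc)
      \<comment> \<open>If \<open>p j < m\<close>, then \<open>p j, x, j + 1\<close> is a 231. If
        \<open>p j = m\<close>, the cycle would end already at position \<open>j\<close>. If
        \<open>p j > m\<close>, then \<open>p j, p (j + 1), m\<close> is a 231.\<close>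
      consider "p j < m" | "p j = m" | "m < p j"
        by linarith
      then show False
      proof cases
        case 1
        then have "t - 1 \<noteq> j"
          using \<open>m < x\<close> cj x_def by auto
        then have "j < t - 1"
          using \<open>j < t\<close> by linarith
        then show False
          using no_231[of j "t - 1" t] 1 \<open>j < t\<close> \<open>m < x\<close> t pj cj by (simp add: x_def)
      next
        case 2
        then show False
          using c_inj[of j "n - 1"] cj j m by (simp add: m_def)
      next
        case 3
        have "Suc t \<noteq> n - 1"
          using 3 c_after cj by (auto simp: m_def)
        then show False
          using no_231[of j "Suc t" "n - 1"] 3 \<open>Suc t \<le> n - 1\<close> \<open>j < t\<close> c_after cj by (simp add: m_def)
      qed
    qed
  qed
  have c_run: "c i = Suc i" if "Suc i < m" for i
    using that
  proof (induction i)
    case 0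
    then show ?case by (simp add: c_def)
  next
    case (Suc i)
    then show ?case using run[of "Suc i"] by (simp add: c_Suc)
  qed
  \<comment> \<open>A value \<open>v < m\<close> already occurs at position
    \<open>v - 1 < m - 1\<close>, so it cannot recur from position \<open>m - 1\<close> on.\<close>
  have c_large: "m \<le> c i" if "m - 1 \<le> i" "i < n" for i
    using c_run[of "c i - 1"] c_inj[of i "c i - 1"] c_range[of i] that m
    by (cases "c i < m") auto
  have c_decr: "c i = m + (n - 1 - i)" if "m - 1 \<le> i" "i \<le> n - 1" for i
    using that
  proof (rule strict_antimono_on_atLeastAtMost_eq[rotated 2])
    fix i j
    assume ij: "m - 1 \<le> i" "i < j" "j \<le> n - 1"
    \<comment> \<open>An ascent \<open>c i < c j\<close> here starts above \<open>m\<close>, so the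
      final entry \<open>m\<close> would complete a 231.\<close>
    show "c j < c i"
    proof (rule ccontr)
      assume "\<not> c j < c i"
      then have "c i < c j"
        using c_inj[of i j] ij by linarith
      moreover have "m < c i"
        using c_large[of i] c_inj[of i "n - 1"] ij by (fastforce simp: m_def)
      moreover have "j \<noteq> n - 1"
        using calculation by (auto simp: m_def)
      ultimately show False
        using no_231[of i j "n - 1"] ij by (simp add: m_def)
    qed
  next
    fix i
    assume "m - 1 \<le> i" "i \<le> n - 1"
    \<comment> \<open>The upper bound is just \<open>n\<close>, written in the form that fits the
      interval of positions from \<open>m - 1\<close> to \<open>n - 1\<close>.\<close>
    then show "m \<le> c i \<and> c i \<le> m + (n - 1 - (m - 1))"
      using c_large[of i] c_range[of i] n m by auto
  qed
  have c_eq: "c i = (run_perm n m ^^ i) 1" if "i < n" for i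
    using c_run[of i] c_decr[of i] that m by (auto simp: funpow_run_perm simp del: One_nat_def)
  have "p x = run_perm n m x" for x
  proof (cases "x \<in> {1..n}")
    case True
    then obtain i where i: "i < n" "c i = x"
      using c_surj by auto
    show ?thesis
    \<comment> \<open>\<open>c_eq\<close> covers only positions below \<open>n\<close>, so the step
      from the last entry \<open>m\<close> back to 1 is treated separately.\<close>
    proof (cases "Suc i < n")
      case True
      then show ?thesis
        using c_Suc[of i] c_eq[of i] c_eq[of "Suc i"] i by simp
    next
      case False
      then have "i = n - 1"
        using i by linarith
      then have "x = m"
        using i by (simp add: m_def)
      then show ?thesis
        using \<open>p m = 1\<close> m by (simp add: run_perm_def)
    qed
  next
    case False
    then show ?thesis
      using permutes_not_in[OF perm] by (auto simp: run_perm_def)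
  qed
  then have "p = run_perm n m"
    by (rule ext)
  then show ?thesis
    using m by (intro bexI[of _ m]) simp_all
qed

theorem theorem4p20:
  fixes n :: nat
  assumes "n \<ge> 2"
  shows "card (cyclic_avoiders n [3, 2, 1] [2, 3, 1]) = n - 1"
proof -
  have "cyclic_avoiders n [3, 2, 1] [2, 3, 1] = run_perm n ` {2..n}"
    using cyclic_avoider_eq_run_perm[OF assms] run_perm_in_cyclic_avoiders by auto
  then show ?thesis
    by (simp add: card_image[OF inj_on_run_perm])
qed

end
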